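(* Let $a,q,r$ be non-negative integers such that $(r-1)a<q\leq ra$, let $q_0=q-(r-1)a$, let $n\geq 1$, and write $a^n$ for the sequence $(a_1,\ldots,a_n)$ with $a_i=a$ for all $i$. Then $$P(a^n;q)=\begin{cases}(q_0^2+q_0)\cdot(a+1)^{r-1}+(a+1)^r-(a+1) & \text{for } n>r,\\ \infty & \text{otherwise.}\end{cases}$$
   Context: For integers $a_1\geq\cdots\geq a_n\geq 0$ ($n\ge 1$) and $q\geq 0$, the value $P(a_1,\ldots,a_n;q)\in\mathbb{Z}_{\geq 0}\cup\{\infty\}$ is defined recursively by: (1) $P(a;0)=0$ and $P(a;q)=\infty$ for $q>0$; (2) for $n>1$, $$P(a_1,\ldots,a_n;q)=\min_{0\leq j\leq\min(q,a_n)}\bigl(P(a_1,\ldots,a_{n-1};q-j)+j\bigr)\cdot(j+1),$$ with the usual conventions for $\infty$. When $r=0$, the power $(a+1)^{r-1}=(a+1)^{-1}$ is taken in $\mathbb{Q}$. *)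

theory Defs
  imports Complex_Main "HOL-Library.Extended_Nat"
begin

text \<open>
  \<open>Pval [a\<^sub>1, \<dots>, a\<^sub>n] q\<close> is the value \<open>P(a\<^sub>1, \<dots>, a\<^sub>n; q)\<close>. The sequences of interest are
  nonempty and non-increasing; the recursion itself does not use monotonicity and is stated
  for all lists. The value on the empty list is a dummy, never reached from a nonempty list.
\<close>

fun Pval :: "nat list \<Rightarrow> nat \<Rightarrow> enat" where
  "Pval as q =
    (if length as \<le> 1 then (if q = 0 then 0 else \<infinity>)
     else Min ((\<lambda>j. (Pval (butlast as) (q - j) + enat j) * enat (j + 1)) ` {0..min q (last as)}))"

declare Pval.simps [simp del]

lemma Pval_single: "Pval [a] q = (if q = 0 then 0 else \<infinity>)"
  by (simp add: Pval.simps)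

lemma Pval_snoc:
  assumes "as \<noteq> []"
  shows "Pval (as @ [a]) q =
    Min ((\<lambda>j. (Pval as (q - j) + enat j) * enat (j + 1)) ` {0..min q a})"
  using assms by (subst Pval.simps) (simp add: Suc_le_eq)

end

theory Submission
  imports Defs
begin

text \<open>
  Write \<open>q = r a + s\<close> with \<open>s \<le> a\<close>. For \<open>r > 0\<close> the minimum in the recursion is attained by the
  largest possible \<open>j = a\<close>, which turns \<open>r a + s\<close> into \<open>(r - 1) a + s\<close>; for \<open>r = 0\<close> it is attained
  by \<open>j = s\<close>. That no other \<open>j\<close> does better is a polynomial inequality, different according to
  whether subtracting \<open>j\<close> borrows from the multiple of \<open>a\<close> (\<open>j > s\<close>) or not.
\<close>

text \<open>Here \<open>r\<close> is one less than in the theorem, so that no negative power of \<open>a + 1\<close> occurs.\<close>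

definition closed_form :: "nat \<Rightarrow> nat \<Rightarrow> nat \<Rightarrow> nat" where
  "closed_form a r s = (s\<^sup>2 + s) * (a + 1) ^ r + ((a + 1) ^ (r + 1) - (a + 1))"

text \<open>Trades the truncated subtraction for ring subtraction: over \<open>int\<close> for the
  polynomial inequalities, over \<open>rat\<close> for the final formula.\<close>

lemma of_nat_closed_form:
  "(of_nat (closed_form a r s) :: 'a :: comm_ring_1) =
    ((of_nat s)\<^sup>2 + of_nat s) * (of_nat a + 1) ^ r + (of_nat a + 1) ^ (r + 1) - (of_nat a + 1)"
proof -
  have "(a + 1) ^ (r + 1) \<ge> (a + 1) ^ 1"
    by (intro power_increasing) auto
  then show ?thesis
    by (simp add: closed_form_def of_nat_diff algebra_simps)
qed

lemma closed_form_0_0 [simp]: "closed_form a 0 0 = 0"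
  by (simp add: closed_form_def)

text \<open>The recursion step for the choice \<open>j = a\<close>.\<close>

lemma closed_form_Suc: "(closed_form a r s + a) * (a + 1) = closed_form a (Suc r) s"
proof -
  have "int ((closed_form a r s + a) * (a + 1)) = int (closed_form a (Suc r) s)"
    by (simp add: of_nat_closed_form algebra_simps)
  then show ?thesis
    by (simp only: of_nat_eq_iff)
qed

text \<open>Substituting \<open>a = U + J + m\<close> with slack \<open>m\<close>, and treating the
  power \<open>B\<close> as an indeterminate, splits the difference of the two sides into visibly
  nonnegative terms; only \<open>U \<le> U\<^sup>2\<close> relies on integrality.\<close>

lemma closed_form_le_no_borrow:
  assumes "u + j \<le> a"
  shows "closed_form a r (u + j) \<le> (closed_form a r u + j) * (j + 1)"
proof -
  define B m where "B = (int a + 1) ^ r" and "m = int a - int u - int j"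
  define U J where "U = int u" and "J = int j"
  have B: "B \<ge> 1"
    unfolding B_def by simp
  have nonneg: "m \<ge> 0" "U \<ge> 0" "J \<ge> 0"
    using assms by (simp_all add: m_def U_def J_def)
  have a: "int a = U + J + m"
    by (simp add: m_def U_def J_def)
  have "U \<le> U\<^sup>2"
    using nonneg by (cases "U = 0") (simp_all add: power2_eq_square)
  have "int ((closed_form a r u + j) * (j + 1)) - int (closed_form a r (u + j)) =
      J * ((B - 1) * (U\<^sup>2 + m) + (U\<^sup>2 - U))"
    unfolding of_nat_mult of_nat_add of_nat_closed_form power_add
    unfolding B_def [symmetric]
    unfolding U_def [symmetric] J_def [symmetric] a
    by (simp add: power2_eq_square algebra_simps)
  also have "\<dots> \<ge> 0"
    using B nonneg \<open>U \<le> U\<^sup>2\<close> by (intro mult_nonneg_nonneg add_nonneg_nonneg) auto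
  finally show ?thesis
    by linarith
qed

text \<open>With \<open>k = a - j\<close>, removing \<open>j\<close> from
  \<open>(r + 1) * a + s\<close> leaves \<open>r * a + (s + k)\<close>.\<close>

lemma closed_form_le_borrow:
  assumes "s + k \<le> a" "j + k = a"
  shows "closed_form a (Suc r) s \<le> (closed_form a r (s + k) + j) * (j + 1)"
proof (cases "k = 0")
  case True
  then show ?thesis
    using assms closed_form_Suc [of a r s] by simp
next
  case False
  define C m where "C = (int a + 1) ^ r" and "m = int a - int s - int k"
  define S K where "S = int s" and "K = int k"
  \<comment> \<open>\<open>K * g\<close> is the difference of the two sides at \<open>C = 1\<close>;
    \<open>K \<ge> 1\<close> makes the factor \<open>2 * S + K - 1\<close> nonnegative.\<close>
  define g where "g = (S + K) * S + m * (2 * S + K - 1)"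
  have C: "C \<ge> 1"
    unfolding C_def by simp
  have nonneg: "m \<ge> 0" "S \<ge> 0" "K \<ge> 1"
    using assms False by (simp_all add: m_def S_def K_def)
  then have "g \<ge> 0"
    by (simp add: g_def)
  have a: "int a = S + K + m" and j: "int j = S + m"
    using assms by (simp_all add: m_def S_def K_def)
  have "int ((closed_form a r (s + k) + j) * (j + 1)) - int (closed_form a (Suc r) s) =
      K * ((C - 1) * (g + S + m) + g)"
    unfolding of_nat_mult of_nat_add of_nat_closed_form power_add power_Suc
    unfolding C_def [symmetric]
    unfolding S_def [symmetric] K_def [symmetric] a j
    by (simp add: g_def power2_eq_square algebra_simps)
  also have "\<dots> \<ge> 0"
    using C nonneg \<open>g \<ge> 0\<close> by (intro mult_nonneg_nonneg add_nonneg_nonneg) auto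
  finally show ?thesis
    by linarith
qed

lemma Pval_replicate_Suc:
  assumes "n \<ge> 1"
  shows "Pval (replicate (Suc n) a) q =
    Min ((\<lambda>j. (Pval (replicate n a) (q - j) + enat j) * enat (j + 1)) ` {0..min q a})"
proof -
  have "replicate n a \<noteq> []"
    using assms by auto
  then have "Pval (replicate n a @ [a]) q =
      Min ((\<lambda>j. (Pval (replicate n a) (q - j) + enat j) * enat (j + 1)) ` {0..min q a})"
    by (rule Pval_snoc)
  then show ?thesis
    by (simp add: replicate_append_same)
qed

theorem Pval_replicate:
  assumes "a > 0" "n \<ge> 1" "s \<le> a"
  shows "Pval (replicate n a) (r * a + s) =
    (if r * a + s \<le> (n - 1) * a then enat (closed_form a r s) else \<infinity>)"
  using assms(2,3)
proof (induction n arbitrary: r s rule: dec_induct)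
  case base
  then show ?case
    using \<open>a > 0\<close> by (auto simp: Pval_single zero_enat_def)
next
  case (step n)
  define q where "q = r * a + s"
  define f where "f j = (Pval (replicate n a) (q - j) + enat j) * enat (j + 1)" for j
  have P: "Pval (replicate (Suc n) a) q = Min (f ` {0..min q a})"
    unfolding f_def using step.hyps(1) by (rule Pval_replicate_Suc)
  have n: "n * a = (n - 1) * a + a"
    using step.hyps by (cases n) auto
  show ?case
  proof (cases "q \<le> n * a")
    case False
    \<comment> \<open>Any \<open>j \<le> a\<close> leaves more than \<open>(n - 1) * a\<close>, so
      every candidate is infinite.\<close>
    have "f j = \<infinity>" if "j \<in> {0..min q a}" for j
    proof -
      define r' s' where "r' = (q - j) div a" and "s' = (q - j) mod a"
      have "r' * a + s' = q - j" "s' \<le> a"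
        using \<open>a > 0\<close> by (simp_all add: r'_def s'_def less_imp_le)
      moreover have "\<not> q - j \<le> (n - 1) * a"
        using that False n by auto
      ultimately have "Pval (replicate n a) (q - j) = \<infinity>"
        using step.IH [of s' r'] by simp
      then show ?thesis
        by (simp add: f_def imult_is_infinity zero_enat_def)
    qed
    then have "f ` {0..min q a} = {\<infinity>}"
      by force
    then show ?thesis
      using P False by (simp add: q_def)
  next
    case True
    have "enat (closed_form a r s) \<le> f j" if j: "j \<in> {0..min q a}" for j
    proof -
      \<comment> \<open>A finite lower bound \<open>m\<close> suffices, and the closed form is one
        whether the previous value is finite or infinite.\<close>
      have "\<exists>m. enat m \<le> Pval (replicate n a) (q - j) \<and> closed_form a r s \<le> (m + j) * (j + 1)"
      proof (cases "j \<le> s")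
        case True
        then have "q - j = r * a + (s - j)"
          by (simp add: q_def)
        then have "enat (closed_form a r (s - j)) \<le> Pval (replicate n a) (q - j)"
          using step.IH [of "s - j" r] step.prems by simp
        moreover have "closed_form a r s \<le> (closed_form a r (s - j) + j) * (j + 1)"
          using closed_form_le_no_borrow [of "s - j" j a r] True step.prems by simp
        ultimately show ?thesis
          by blast
      next
        case False
        \<comment> \<open>\<open>r = 0\<close> is excluded, since it would give
          \<open>j \<le> q = s\<close>.\<close>
        then obtain r' where r: "r = Suc r'"
          using j by (cases r) (auto simp: q_def)
        define k where "k = a - j"
        have k: "j + k = a" "s + k \<le> a"
          using j False by (auto simp: k_def)
        have "q - j = r' * a + (s + k)"
          using k by (auto simp: q_def r)
        then have "enat (closed_form a r' (s + k)) \<le> Pval (replicate n a) (q - j)"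
          using step.IH [of "s + k" r'] k by simp
        then show ?thesis
          using closed_form_le_borrow [OF k(2,1), of r'] r by blast
      qed
      then obtain m where m: "enat m \<le> Pval (replicate n a) (q - j)"
        "closed_form a r s \<le> (m + j) * (j + 1)"
        by blast
      have "enat (closed_form a r s) \<le> (enat m + enat j) * enat (j + 1)"
        using m(2) by simp
      also have "\<dots> \<le> f j"
        unfolding f_def using m(1) by (intro mult_right_mono add_right_mono) auto
      finally show ?thesis .
    qed
    moreover have "enat (closed_form a r s) \<in> f ` {0..min q a}"
    proof (cases r)
      case 0
      \<comment> \<open>Choosing \<open>j = s\<close> leaves \<open>0\<close>, so the candidate is
        \<open>s * (s + 1)\<close>.\<close>
      have "f s = enat (closed_form a r s)"
        using step.IH [of 0 0] by (simp add: f_def q_def 0 closed_form_def power2_eq_square)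
      then show ?thesis
        using step.prems by (intro image_eqI [of _ _ s]) (auto simp: q_def)
    next
      case (Suc r')
      have "q - a = r' * a + s"
        by (simp add: q_def Suc)
      moreover have "r' * a + s \<le> (n - 1) * a"
        using True n by (simp add: q_def Suc)
      ultimately have "Pval (replicate n a) (q - a) = enat (closed_form a r' s)"
        using step.IH [of s r'] step.prems by simp
      then have "f a = enat (closed_form a r s)"
        using closed_form_Suc [of a r' s] by (simp add: f_def Suc)
      then show ?thesis
        by (intro image_eqI [of _ _ a]) (auto simp: q_def Suc)
    qed
    ultimately have "Min (f ` {0..min q a}) = enat (closed_form a r s)"
      by (intro Min_eqI) auto
    then show ?thesis
      using P True by (simp add: q_def)
  qed
qed

theorem lemma3p4:
  fixes a q r n :: nat and q0 :: int
  assumes "(int r - 1) * int a < int q"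
    and "q \<le> r * a"
    and "q0 = int q - (int r - 1) * int a"
    and "n \<ge> 1"
  shows "if n > r
    then \<exists>m. Pval (replicate n a) q = enat m \<and>
      (of_nat m :: rat) =
        ((of_int q0)\<^sup>2 + of_int q0) * (of_nat a + 1) powi (int r - 1)
          + (of_nat a + 1) ^ r - (of_nat a + 1)
    else Pval (replicate n a) q = \<infinity>"
proof -
  have "a > 0"
    using assms(1,2) by (cases a) auto
  show ?thesis
  proof (cases r)
    case 0
    \<comment> \<open>Here \<open>q = 0\<close> and \<open>q0 = a\<close>; as
      \<open>(a\<^sup>2 + a) / (a + 1) = a\<close>, the formula collapses to
      \<open>a + 1 - (a + 1) = 0\<close>.\<close>
    have "Pval (replicate n a) q = enat 0"
      using Pval_replicate [OF \<open>a > 0\<close> assms(4), of 0 0] assms(2) 0 by simp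
    moreover have "((of_nat a)\<^sup>2 + of_nat a) * (of_nat a + 1 :: rat) powi - 1 = of_nat a"
    proof -
      have "(of_nat a + 1 :: rat) \<noteq> 0"
        using of_nat_neq_0 [of a, where ?'a = rat] by (simp add: add.commute)
      then show ?thesis
        by (simp add: power_int_minus field_simps power2_eq_square)
    qed
    ultimately show ?thesis
      using assms by (simp add: 0)
  next
    case (Suc r')
    define s where "s = q - r' * a"
    have "r' * a < q"
      using assms(1) by (simp add: Suc flip: of_nat_mult)
    then have s: "q = r' * a + s" "0 < s" "s \<le> a"
      using assms(2) by (auto simp: s_def Suc)
    have q0: "q0 = int s"
      by (simp add: assms(3) s Suc)
    have *: "Pval (replicate n a) q =
        (if q \<le> (n - 1) * a then enat (closed_form a r' s) else \<infinity>)"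
      using Pval_replicate [OF \<open>a > 0\<close> assms(4) s(3), of r'] s(1) by simp
    show ?thesis
    proof (cases "n > r")
      case True
      then have "r * a \<le> (n - 1) * a"
        by (intro mult_right_mono) auto
      with assms(2) have "q \<le> (n - 1) * a"
        by (rule order_trans)
      with * have "Pval (replicate n a) q = enat (closed_form a r' s)"
        by simp
      then show ?thesis
        using True by (simp add: of_nat_closed_form q0 Suc)
    next
      case False
      then have "(n - 1) * a \<le> r' * a"
        using Suc by (intro mult_right_mono) auto
      \<comment> \<open>The strict lower bound on \<open>q\<close> matters: \<open>0 < s\<close>
        puts \<open>q\<close> above \<open>r' * a\<close>, hence above
        \<open>(n - 1) * a\<close>.\<close>
      with s have "\<not> q \<le> (n - 1) * a"
        by linarith
      with * False show ?thesis
        by simp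
    qed
  qed
qed

end
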